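(* Let $D=(\mathcal P,\mathcal B)$ be a symmetric $(v,k,\lambda)$-design with $k\ge 100$. Then \[\gamma_e(D)=v-\alpha,\] where $\alpha$ is the maximum size of an equinumerous incidence-free pair $(X,Y)$ in $D$.
   Context: An incidence structure is a pair $D=(\mathcal P,\mathcal B)$ where $\mathcal B$ is a collection of subsets (blocks) of the point set $\mathcal P$; a point $P$ and block $B$ are incident if $P\in B$. A $(v,k,\lambda)$-design is an incidence structure with $v$ points, every block incident with $k$ points, every point incident with $r$ blocks, and any two distinct points incident with exactly $\lambda\ge 1$ common blocks; it is symmetric if the number of blocks equals $v$ (then $r=k$ and any two distinct blocks share exactly $\lambda$ points). The incidence graph $I(D)$ is the bipartite graph with parts $\mathcal P$ and $\mathcal B$, with $P\sim B$ iff $P\in B$. An edge dominating set of a graph is a set $\Gamma$ of edges such that every edge shares a vertex with some edge of $\Gamma$; $\gamma_e(D)$ denotes the minimum size of an edge dominating set of $I(D)$. A pair $(X,Y)$ with $X\subseteq\mathcal P$, $Y\subseteq\mathcal B$ is incidence-free if no point of $X$ is incident with a block of $Y$; it is equinumerous if $|X|=|Y|$, and then $|X|$ is its size. *)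

theory Defs
  imports Main
begin

section \<open>Incidence structures and designs\<close>

locale incidence_structure =
  fixes \<P> :: "'a set" and \<B> :: "'a set set"
  assumes blocks_subset: "B \<in> \<B> \<Longrightarrow> B \<subseteq> \<P>"

text \<open>The number of points is required to be finite explicitly, because \<^const>\<open>card\<close>
  of an infinite set is 0.  Finiteness of the blocks and of their number follows.
  The parameter \<open>l\<close> is the number of blocks on two points.\<close>

locale design = incidence_structure \<P> \<B>
  for \<P> :: "'a set" and \<B> :: "'a set set" +
  fixes v k l :: nat
  assumes finite_points: "finite \<P>"
    and card_points: "card \<P> = v"
    and card_block: "B \<in> \<B> \<Longrightarrow> card B = k"
    and point_regular: "\<exists>r. \<forall>p\<in>\<P>. card {B \<in> \<B>. p \<in> B} = r"
    and pair_balanced: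
      "\<lbrakk>p \<in> \<P>; q \<in> \<P>; p \<noteq> q\<rbrakk> \<Longrightarrow> card {B \<in> \<B>. p \<in> B \<and> q \<in> B} = l"
    and l_pos: "l \<ge> 1"

locale symmetric_design = design \<P> \<B> v k l
  for \<P> :: "'a set" and \<B> :: "'a set set" and v k l :: nat +
  assumes card_blocks: "card \<B> = v"


section \<open>Edge domination\<close>

text \<open>A simple graph is a pair of a vertex set and a set of two-element sets of vertices.\<close>

type_synonym 'v graph = "'v set \<times> 'v set set"

abbreviation verts :: "'v graph \<Rightarrow> 'v set" where
  "verts G \<equiv> fst G"

abbreviation edges :: "'v graph \<Rightarrow> 'v set set" where
  "edges G \<equiv> snd G"

definition edge_dominating_set :: "'v graph \<Rightarrow> 'v set set \<Rightarrow> bool" where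
  "edge_dominating_set G \<Gamma> \<longleftrightarrow>
     \<Gamma> \<subseteq> edges G \<and> (\<forall>e\<in>edges G. \<exists>f\<in>\<Gamma>. e \<inter> f \<noteq> {})"

definition incidence_graph :: "'a set \<Rightarrow> 'a set set \<Rightarrow> ('a + 'a set) graph" where
  "incidence_graph \<P> \<B> =
     (\<P> <+> \<B>, {{Inl p, Inr B} | p B. p \<in> \<P> \<and> B \<in> \<B> \<and> p \<in> B})"

definition gamma_e :: "'a set \<Rightarrow> 'a set set \<Rightarrow> nat" where
  "gamma_e \<P> \<B> = Min {card \<Gamma> | \<Gamma>. edge_dominating_set (incidence_graph \<P> \<B>) \<Gamma>}"


section \<open>Incidence-free pairs\<close>

definition incidence_free :: "'a set \<Rightarrow> 'a set set \<Rightarrow> 'a set \<Rightarrow> 'a set set \<Rightarrow> bool" where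
  "incidence_free \<P> \<B> X Y \<longleftrightarrow> X \<subseteq> \<P> \<and> Y \<subseteq> \<B> \<and> (\<forall>p\<in>X. \<forall>B\<in>Y. p \<notin> B)"

definition max_equinumerous_size :: "'a set \<Rightarrow> 'a set set \<Rightarrow> nat" where
  "max_equinumerous_size \<P> \<B> =
     Max {card X | X Y. incidence_free \<P> \<B> X Y \<and> card X = card Y}"


section \<open>The extrema are attained\<close>

context design
begin

lemma finite_blocks: "finite \<B>"
  using blocks_subset finite_points by (meson Sup_least finite_UnionD finite_subset)

lemma finite_incidence_graph_edges: "finite (edges (incidence_graph \<P> \<B>))"
proof (rule finite_subset)
  show "edges (incidence_graph \<P> \<B>) \<subseteq> (\<lambda>(p, B). {Inl p, Inr B}) ` (\<P> \<times> \<B>)"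
    by (auto simp: incidence_graph_def)
  show "finite ((\<lambda>(p, B). {Inl p, Inr B} :: ('a + 'a set) set) ` (\<P> \<times> \<B>))"
    using finite_points finite_blocks by blast
qed

lemma gamma_e_attained:
  "\<exists>\<Gamma>. edge_dominating_set (incidence_graph \<P> \<B>) \<Gamma> \<and> card \<Gamma> = gamma_e \<P> \<B>"
  "edge_dominating_set (incidence_graph \<P> \<B>) \<Gamma> \<Longrightarrow> gamma_e \<P> \<B> \<le> card \<Gamma>"
proof -
  let ?S = "{card \<Gamma> | \<Gamma>. edge_dominating_set (incidence_graph \<P> \<B>) \<Gamma>}"
  have "edge_dominating_set (incidence_graph \<P> \<B>) (edges (incidence_graph \<P> \<B>))"
    by (auto simp: edge_dominating_set_def incidence_graph_def)
  then have ne: "?S \<noteq> {}" by blast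
  have "?S \<subseteq> card ` Pow (edges (incidence_graph \<P> \<B>))"
    by (auto simp: edge_dominating_set_def)
  then have fin: "finite ?S"
    by (rule finite_subset) (simp add: finite_incidence_graph_edges)
  show "\<exists>\<Gamma>. edge_dominating_set (incidence_graph \<P> \<B>) \<Gamma> \<and> card \<Gamma> = gamma_e \<P> \<B>"
    using Min_in[OF fin ne] unfolding gamma_e_def by auto
  show "gamma_e \<P> \<B> \<le> card \<Gamma>" if "edge_dominating_set (incidence_graph \<P> \<B>) \<Gamma>"
    unfolding gamma_e_def using that by (intro Min_le[OF fin]) blast
qed

lemma max_equinumerous_size_attained:
  "\<exists>X Y. incidence_free \<P> \<B> X Y \<and> card X = card Y \<and> card X = max_equinumerous_size \<P> \<B>"
  "incidence_free \<P> \<B> X Y \<Longrightarrow> card X = card Y \<Longrightarrow> card X \<le> max_equinumerous_size \<P> \<B>"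
proof -
  let ?S = "{card X | X Y. incidence_free \<P> \<B> X Y \<and> card X = card Y}"
  have "incidence_free \<P> \<B> {} {}"
    by (simp add: incidence_free_def)
  then have ne: "?S \<noteq> {}" by fastforce
  have "?S \<subseteq> card ` Pow \<P>"
    by (auto simp: incidence_free_def)
  then have fin: "finite ?S"
    by (rule finite_subset) (simp add: finite_points)
  show "\<exists>X Y. incidence_free \<P> \<B> X Y \<and> card X = card Y \<and> card X = max_equinumerous_size \<P> \<B>"
  proof -
    obtain X Y where "Max ?S = card X" "incidence_free \<P> \<B> X Y" "card X = card Y"
      using Max_in[OF fin ne] by blast
    then show ?thesis
      unfolding max_equinumerous_size_def by metis
  qed
  show "card X \<le> max_equinumerous_size \<P> \<B>" if "incidence_free \<P> \<B> X Y" "card X = card Y"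
    unfolding max_equinumerous_size_def using that by (intro Max_ge[OF fin]) blast
qed

end

end

theory Submission
  imports Defs "HOL-Analysis.Convex"
begin

text \<open>The points and blocks missed by an edge dominating set form an incidence-free pair, which gives
  \<open>v - \<alpha>\<close> as a lower bound.  Conversely, let \<open>(X, Y)\<close> be an equinumerous incidence-free pair of maximum
  size \<open>\<alpha>\<close>; any perfect matching between the points outside \<open>X\<close> and the blocks outside \<open>Y\<close> is an edge
  dominating set of size \<open>v - \<alpha>\<close>.  If there is none, Hall's condition fails for a set \<open>S\<close> of points
  whose set \<open>T\<close> of neighbours outside \<open>Y\<close> is smaller than \<open>S\<close>.  Up to duality \<open>S\<close> has
  at most \<open>\<alpha>\<close> points, by maximality of \<open>\<alpha>\<close>.  The second-moment bound \<open>k x y \<le> (v - x) (v - y)\<close> for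
  incidence-free pairs of sizes \<open>x\<close>, \<open>y\<close>, applied to \<open>(X, Y)\<close> and to \<open>S\<close> with its non-neighbours
  outside \<open>Y\<close>, gives \<open>5 k |S| \<le> 6 \<alpha>\<close>.  Joining a point of \<open>S\<close> to all points of \<open>X\<close> takes at least
  \<open>l \<alpha> / (k - 1)\<close> blocks of \<open>T\<close>.  Since \<open>|T| < |S|\<close>, this forces \<open>l = 1\<close> and every point of \<open>S\<close> to lie on
  more than \<open>4/5\<close> of the blocks of \<open>T\<close>, so that two points of \<open>S\<close> share more than one block.\<close>

section \<open>Double counting\<close>

lemma sum_card_filter_swap:
  assumes "finite A" "finite B"
  shows "(\<Sum>b\<in>B. card {a\<in>A. R a b}) = (\<Sum>a\<in>A. card {b\<in>B. R a b})"
proof -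
  have "(\<Sum>b\<in>B. card {a\<in>A. R a b}) = (\<Sum>b\<in>B. \<Sum>a\<in>A. of_bool (R a b))"
    using assms by (simp add: sum_of_bool_eq Collect_conj_eq)
  also have "\<dots> = (\<Sum>a\<in>A. \<Sum>b\<in>B. of_bool (R a b))"
    by (rule sum.swap)
  also have "\<dots> = (\<Sum>a\<in>A. card {b\<in>B. R a b})"
    using assms by (simp add: sum_of_bool_eq Collect_conj_eq)
  finally show ?thesis .
qed

lemma sum_card_filter_square:
  assumes "finite A" "finite B"
  shows "(\<Sum>b\<in>B. (card {a\<in>A. R a b})\<^sup>2) = (\<Sum>a\<in>A. \<Sum>a'\<in>A. card {b\<in>B. R a b \<and> R a' b})"
proof -
  have "(card {a\<in>A. R a b})\<^sup>2 = (\<Sum>a\<in>A. card {a'\<in>A. R a b \<and> R a' b})" for b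
  proof -
    have "(\<Sum>a\<in>A. card {a'\<in>A. R a b \<and> R a' b}) = (\<Sum>a\<in>A. if R a b then card {a\<in>A. R a b} else 0)"
      by (intro sum.cong) auto
    also have "\<dots> = (\<Sum>a\<in>{a\<in>A. R a b}. card {a\<in>A. R a b})"
      using assms by (subst sum.inter_filter) auto
    finally show ?thesis
      by (simp add: power2_eq_square)
  qed
  then have "(\<Sum>b\<in>B. (card {a\<in>A. R a b})\<^sup>2) = (\<Sum>b\<in>B. \<Sum>a\<in>A. card {a'\<in>A. R a b \<and> R a' b})"
    by simp
  also have "\<dots> = (\<Sum>a\<in>A. \<Sum>b\<in>B. card {a'\<in>A. R a b \<and> R a' b})"
    by (rule sum.swap)
  also have "\<dots> = (\<Sum>a\<in>A. \<Sum>a'\<in>A. card {b\<in>B. R a b \<and> R a' b})"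
    by (intro sum.cong sum_card_filter_swap assms refl)
  finally show ?thesis .
qed

section \<open>Hall's marriage theorem\<close>

text \<open>Induction on the size of \<open>A\<close>. Either some proper nonempty subset is tight,
  and it and its complement are matched separately, or every such subset has a spare neighbour, and
  one element can be matched at will.\<close>

theorem Hall:
  assumes "finite A" and "\<And>a. a \<in> A \<Longrightarrow> finite (N a)"
    and "\<And>S. S \<subseteq> A \<Longrightarrow> card S \<le> card (\<Union>(N ` S))"
  shows "\<exists>f. inj_on f A \<and> (\<forall>a\<in>A. f a \<in> N a)"
  using assms
proof (induction "card A" arbitrary: A N rule: less_induct)
  case less
  note fin = less.prems(1) and finN = less.prems(2) and hall = less.prems(3)
  show ?case
  proof (cases "\<exists>S. S \<subset> A \<and> S \<noteq> {} \<and> card S = card (\<Union>(N ` S))")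
    case True
    then obtain S where S: "S \<subset> A" "S \<noteq> {}" "card S = card (\<Union>(N ` S))" by blast
    have finS: "finite S" using S fin finite_subset by blast
    obtain f where f: "inj_on f S" "\<And>a. a \<in> S \<Longrightarrow> f a \<in> N a"
      using less.hyps[of S N] S fin finS finN hall psubset_card_mono[OF fin S(1)] by blast
    let ?M = "\<lambda>a. N a - \<Union>(N ` S)"
    \<comment> \<open>Hall's condition for \<open>U \<union> S\<close> minus the equality for
      \<open>S\<close>.\<close>
    have "card U \<le> card (\<Union>(?M ` U))" if U: "U \<subseteq> A - S" for U
    proof -
      have finU: "finite U" using U fin finite_subset by blast
      have "card U + card S = card (U \<union> S)"
        using U finU finS by (subst card_Un_disjoint) auto
      also have "\<dots> \<le> card (\<Union>(N ` (U \<union> S)))"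
        using U S by (intro hall) auto
      also have "\<Union>(N ` (U \<union> S)) = \<Union>(?M ` U) \<union> \<Union>(N ` S)" by auto
      also have "card \<dots> \<le> card (\<Union>(?M ` U)) + card (\<Union>(N ` S))" by (rule card_Un_le)
      finally show ?thesis using S(3) by simp
    qed
    moreover have "card (A - S) < card A"
      using S fin by (intro psubset_card_mono) auto
    ultimately obtain g where g: "inj_on g (A - S)" "\<And>a. a \<in> A - S \<Longrightarrow> g a \<in> ?M a"
      using less.hyps[of "A - S" ?M] fin finN by (metis Diff_iff finite_Diff)
    let ?h = "\<lambda>a. if a \<in> S then f a else g a"
    have "inj_on ?h A"
    proof (rule inj_onI)
      fix x y assume xy: "x \<in> A" "y \<in> A" "?h x = ?h y"
      show "x = y"
      proof (cases "x \<in> S"; cases "y \<in> S")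
        assume "x \<in> S" "y \<in> S" then show ?thesis using xy f(1) by (auto dest: inj_onD)
      next
        assume "x \<notin> S" "y \<notin> S" then show ?thesis using xy g(1) by (auto dest: inj_onD)
      next
        assume "x \<in> S" "y \<notin> S" then show ?thesis using xy f(2)[of x] g(2)[of y] by auto
      next
        assume "x \<notin> S" "y \<in> S" then show ?thesis using xy f(2)[of y] g(2)[of x] by auto
      qed
    qed
    moreover have "\<forall>a\<in>A. ?h a \<in> N a" using f(2) g(2) by auto
    ultimately show ?thesis by (intro exI[of _ ?h]) blast
  next
    case False
    show ?thesis
    proof (cases "A = {}")
      case True
      then show ?thesis by simp
    next
      case ne: False
      then obtain a where a: "a \<in> A" by blast
      have "card {a} \<le> card (\<Union>(N ` {a}))" using a by (intro hall) auto
      then obtain b where b: "b \<in> N a" by (cases "N a = {}") auto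
      let ?M = "\<lambda>x. N x - {b}"
      have "card U \<le> card (\<Union>(?M ` U))" if U: "U \<subseteq> A - {a}" for U
      proof (cases "U = {}")
        case nU: False
        \<comment> \<open>\<open>U\<close> omits \<open>a\<close>, so it is proper and not tight;
          the strict inequality pays for the loss of \<open>b\<close>.\<close>
        have "card U \<noteq> card (\<Union>(N ` U))" "card U \<le> card (\<Union>(N ` U))"
          using False nU U a hall[of U] by blast+
        moreover have "\<Union>(?M ` U) = \<Union>(N ` U) - {b}" by auto
        moreover have "card (\<Union>(N ` U)) - 1 \<le> card (\<Union>(N ` U) - {b})"
          by (simp add: card_Diff_singleton_if)
        ultimately show ?thesis by simp
      qed simp
      moreover have "card (A - {a}) < card A"
        using a fin by (rule card_Diff1_less[rotated])
      ultimately obtain g where g: "inj_on g (A - {a})" "\<And>x. x \<in> A - {a} \<Longrightarrow> g x \<in> ?M x"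
        using less.hyps[of "A - {a}" ?M] fin finN by (metis Diff_iff finite_Diff)
      have "inj_on (g(a := b)) A"
        using g unfolding inj_on_def by (metis DiffD2 DiffI fun_upd_apply singletonD singletonI)
      moreover have "\<forall>x\<in>A. (g(a := b)) x \<in> N x" using g(2) b by auto
      ultimately show ?thesis by blast
    qed
  qed
qed

section \<open>Numerical estimate\<close>

text \<open>Meant for \<open>a\<close> the common size of \<open>X\<close> and \<open>Y\<close>,
  \<open>s\<close> the size of \<open>S\<close> and \<open>z\<close> the number of blocks outside
  \<open>Y\<close> that miss \<open>S\<close>; \<open>v \<le> a + s + z\<close> then comes from the
  failure of Hall's condition.\<close>

lemma small_set_bound:
  fixes k v a s z :: real
  assumes k: "k \<ge> 100" and a: "a \<le> v" and s: "1 \<le> s" "s \<le> a" and z: "v \<le> a + s + z" "z \<le> v"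
    and mix_a: "k * a * a \<le> (v - a) * (v - a)"
    and mix_s: "k * s * z \<le> (v - s) * (v - z)"
  shows "5 * (k * s) \<le> 6 * a"
proof -
  \<comment> \<open>Since 100 is the square of 10, \<open>mix_a\<close> forces
    \<open>v - a \<ge> 10 * a\<close>.\<close>
  have v: "11 * a \<le> v"
  proof (rule ccontr)
    assume "\<not> 11 * a \<le> v"
    then have "(v - a) * (v - a) < (10 * a) * (10 * a)"
      using a s by (intro mult_strict_mono') auto
    moreover have "100 * (a * a) \<le> k * (a * a)"
      using k by (intro mult_right_mono) auto
    ultimately show False using mix_a by (simp add: algebra_simps)
  qed
  \<comment> \<open>Used twice: the crude bound on \<open>s\<close> obtained from \<open>s \<le> a\<close> is fed back in to sharpen the constant.\<close>
  have bound: "k * s * c \<le> d * a" if c: "c * v \<le> z" and d: "v - z \<le> d * a" for c d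
  proof -
    have "k * s * (c * v) \<le> k * s * z"
      using c k s by (intro mult_left_mono) auto
    also have "\<dots> \<le> v * (d * a)"
      using mix_s d z s v a by (elim order_trans, intro mult_mono) auto
    finally have "(k * s * c) * v \<le> (d * a) * v" by (simp add: algebra_simps)
    then show ?thesis using v s by simp
  qed
  \<comment> \<open>From \<open>s \<le> a\<close>: \<open>v - z \<le> 2 * a\<close>, which is at
    most 2/11 of \<open>v\<close>.\<close>
  have "k * s * (9 / 11) \<le> 2 * a"
    using v s z by (intro bound) auto
  moreover have "100 * s \<le> k * s"
    using k s by (intro mult_right_mono) auto
  ultimately have s_small: "900 * s \<le> 22 * a" by simp
  \<comment> \<open>Now \<open>a + s\<close> is at most 922/900 of \<open>a\<close>, hence less than
    a tenth of \<open>v\<close>. The resulting factor 9220/8100 is below 6/5.\<close>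
  have "k * s * (9 / 10) \<le> (922 / 900) * a"
    using v s z s_small by (intro bound) auto
  then show ?thesis using s by simp
qed

section \<open>Symmetric designs and their duals\<close>

text \<open>An abstract relation replaces membership so that points and blocks can exchange
  roles.\<close>

locale symmetric_incidence =
  fixes P :: "'p set" and Q :: "'b set" and I :: "'p \<Rightarrow> 'b \<Rightarrow> bool" and v k l :: nat
  assumes fin_P: "finite P" and fin_Q: "finite Q"
    and card_P: "card P = v" and card_Q: "card Q = v"
    and point_degree: "p \<in> P \<Longrightarrow> card {b\<in>Q. I p b} = k"
    and block_degree: "b \<in> Q \<Longrightarrow> card {p\<in>P. I p b} = k"
    and pair_degree: "p \<in> P \<Longrightarrow> q \<in> P \<Longrightarrow> p \<noteq> q \<Longrightarrow> card {b\<in>Q. I p b \<and> I q b} = l"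
begin

lemma sum_pair_degree:
  assumes "p \<in> A" "A \<subseteq> P"
  shows "real (\<Sum>q\<in>A. card {b\<in>Q. I p b \<and> I q b}) = k + (real (card A) - 1) * l"
proof -
  have fA: "finite A" using assms fin_P finite_subset by blast
  have "(\<Sum>q\<in>A. card {b\<in>Q. I p b \<and> I q b}) = k + (\<Sum>q\<in>A-{p}. card {b\<in>Q. I p b \<and> I q b})"
    using assms fA point_degree[of p] by (subst sum.remove[of _ p]) auto
  also have "(\<Sum>q\<in>A-{p}. card {b\<in>Q. I p b \<and> I q b}) = (\<Sum>q\<in>A-{p}. l)"
    using assms by (intro sum.cong pair_degree) auto
  finally show ?thesis
    using assms fA card_gt_0_iff[of A] by (auto simp: of_nat_diff Suc_le_eq)
qed

lemma first_moment:
  assumes "A \<subseteq> P"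
  shows "(\<Sum>b\<in>Q. real (card {p\<in>A. I p b})) = card A * real k"
proof -
  have "(\<Sum>b\<in>Q. card {p\<in>A. I p b}) = (\<Sum>p\<in>A. card {b\<in>Q. I p b})"
    using assms fin_P fin_Q finite_subset by (intro sum_card_filter_swap) auto
  also have "\<dots> = card A * k"
    using assms point_degree by (simp add: subset_iff)
  finally show ?thesis
    by (metis of_nat_mult of_nat_sum)
qed

lemma second_moment:
  assumes "A \<subseteq> P"
  shows "(\<Sum>b\<in>Q. (real (card {p\<in>A. I p b}))\<^sup>2) = card A * (k + (real (card A) - 1) * l)"
proof -
  have "(\<Sum>b\<in>Q. (card {p\<in>A. I p b})\<^sup>2) = (\<Sum>p\<in>A. \<Sum>q\<in>A. card {b\<in>Q. I p b \<and> I q b})"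
    using assms fin_P fin_Q finite_subset by (intro sum_card_filter_square) auto
  then have "real (\<Sum>b\<in>Q. (card {p\<in>A. I p b})\<^sup>2)
      = (\<Sum>p\<in>A. real (\<Sum>q\<in>A. card {b\<in>Q. I p b \<and> I q b}))"
    by simp
  also have "\<dots> = (\<Sum>p\<in>A. k + (real (card A) - 1) * l)"
    using assms sum_pair_degree by (intro sum.cong) auto
  finally show ?thesis
    by simp
qed

text \<open>Counts the incidences of all points with the blocks through a fixed point; this is the
  classical \<open>k * (k - 1) = l * (v - 1)\<close>.\<close>

lemma degree_square:
  assumes "v > 0"
  shows "(real k)\<^sup>2 = real k - l + real l * v"
proof -
  obtain p where p: "p \<in> P" using assms card_P by fastforce
  have "(\<Sum>b\<in>{b\<in>Q. I p b}. card {q\<in>P. I q b}) = (\<Sum>q\<in>P. card {b\<in>{b\<in>Q. I p b}. I q b})"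
    using fin_P fin_Q by (intro sum_card_filter_swap) auto
  also have "\<dots> = (\<Sum>q\<in>P. card {b\<in>Q. I p b \<and> I q b})"
    by (intro sum.cong arg_cong[where f = card]) auto
  also have "(\<Sum>b\<in>{b\<in>Q. I p b}. card {q\<in>P. I q b}) = k * k"
    using p point_degree block_degree by simp
  finally have "real (k * k) = k + (real v - 1) * l"
    using sum_pair_degree[OF p] card_P by simp
  then show ?thesis
    by (simp add: power2_eq_square algebra_simps)
qed

text \<open>The sizes of the intersections with a fixed block have mean \<open>l\<close> and variance 0.\<close>

lemma dual_pair_degree:
  assumes "b \<in> Q" "c \<in> Q" "b \<noteq> c"
  shows "card {p\<in>P. I p b \<and> I p c} = l"
proof -
  define A where "A = {p\<in>P. I p b}"
  have A: "A \<subseteq> P" and cA: "card A = k" unfolding A_def using assms block_degree by auto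
  define f where "f = (\<lambda>c. real (card {p\<in>A. I p c}))"
  have fb: "f b = k"
  proof -
    have "{p\<in>A. I p b} = A" unfolding A_def by auto
    then show ?thesis unfolding f_def using cA by simp
  qed
  have v: "v > 0" using assms card_Q fin_Q card_gt_0_iff by blast
  have s1: "(\<Sum>c\<in>Q-{b}. f c) = real k * k - k"
    using first_moment[OF A] sum.remove[OF fin_Q assms(1), of f] fb cA by (simp add: f_def)
  have s2: "(\<Sum>c\<in>Q-{b}. (f c)\<^sup>2) = real k * (k + (real k - 1) * l) - real k * k"
    using second_moment[OF A] sum.remove[OF fin_Q assms(1), of "\<lambda>c. (f c)\<^sup>2"] fb cA
    by (simp add: f_def power2_eq_square)
  have "(\<Sum>c\<in>Q-{b}. (f c - l)\<^sup>2)
      = (\<Sum>c\<in>Q-{b}. (f c)\<^sup>2) - 2 * l * (\<Sum>c\<in>Q-{b}. f c) + (real v - 1) * (real l)\<^sup>2"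
    using assms v fin_Q card_Q
    by (simp add: power2_diff sum.distrib sum_subtractf sum_distrib_left of_nat_diff algebra_simps)
  also have "\<dots> = - real l * ((real k)\<^sup>2 - (real k - l + real l * v))"
    unfolding s1 s2 by (simp add: power2_eq_square algebra_simps)
  also have "\<dots> = 0"
    using degree_square[OF v] by simp
  finally have "\<forall>c\<in>Q-{b}. (f c - l)\<^sup>2 = 0"
    using fin_Q by (subst (asm) sum_nonneg_eq_0_iff) auto
  then have "f c = l" using assms by auto
  moreover have "{p\<in>A. I p c} = {p\<in>P. I p b \<and> I p c}" unfolding A_def by auto
  ultimately show ?thesis unfolding f_def by simp
qed

lemma dual: "symmetric_incidence Q P (\<lambda>b p. I p b) v k l"
  using fin_P fin_Q card_P card_Q point_degree block_degree dual_pair_degree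
  by unfold_locales auto

section \<open>Incidence-free pairs\<close>

definition free :: "'p set \<Rightarrow> 'b set \<Rightarrow> bool" where
  "free X Y \<longleftrightarrow> X \<subseteq> P \<and> Y \<subseteq> Q \<and> (\<forall>p\<in>X. \<forall>b\<in>Y. \<not> I p b)"

lemma card_free_le:
  assumes "free X Y"
  shows "card X \<le> v" "card Y \<le> v"
  using assms card_mono[OF fin_P, of X] card_mono[OF fin_Q, of Y] card_P card_Q
  by (auto simp: free_def)

text \<open>Cauchy-Schwarz for the numbers of points of \<open>X\<close> on the blocks outside
  \<open>Y\<close>: blocks in \<open>Y\<close> contribute nothing to either moment, so only
  \<open>v - y\<close> terms remain.\<close>

lemma free_mixing:
  assumes "free X Y"
  shows "real k * card X * card Y \<le> (real v - card X) * (real v - card Y)"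
proof (cases "card X = 0 \<or> k = 0")
  case True
  then show ?thesis using card_free_le[OF assms] by auto
next
  case False
  have X: "X \<subseteq> P" and Y: "Y \<subseteq> Q" and fr: "\<And>p b. p \<in> X \<Longrightarrow> b \<in> Y \<Longrightarrow> \<not> I p b"
    using assms by (auto simp: free_def)
  define x where "x = real (card X)"
  define y where "y = real (card Y)"
  have x0: "x > 0" using False by (simp add: x_def)
  have v: "v > 0" using False card_free_le[OF assms] by simp
  define f where "f = (\<lambda>b. real (card {p\<in>X. I p b}))"
  have f0: "f b = 0" if "b \<in> Y" for b
    using that fr[of _ b] by (auto simp: f_def card_eq_0_iff)
  have "(\<Sum>b\<in>Q-Y. f b) = (\<Sum>b\<in>Q. f b)" "(\<Sum>b\<in>Q-Y. (f b)\<^sup>2) = (\<Sum>b\<in>Q. (f b)\<^sup>2)"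
    using f0 fin_Q by (auto intro!: sum.mono_neutral_left)
  then have s: "(\<Sum>b\<in>Q-Y. f b) = x * k" "(\<Sum>b\<in>Q-Y. (f b)\<^sup>2) = x * (k + (x - 1) * l)"
    using first_moment[OF X] second_moment[OF X] by (simp_all add: f_def x_def)
  have cd: "real (card (Q - Y)) = v - y"
    using Y fin_Q card_Q card_free_le[OF assms]
    by (simp add: card_Diff_subset finite_subset y_def of_nat_diff)
  have "x * (x * (real k)\<^sup>2) \<le> x * ((k + (x - 1) * l) * (v - y))"
    using sum_squared_le_sum_of_squares[of f "Q - Y"] unfolding s cd
    by (simp add: power2_eq_square algebra_simps)
  \<comment> \<open>The factor \<open>v\<close> creates \<open>l * v\<close>, which
    \<open>degree_square\<close> expresses through \<open>k\<close> and \<open>l\<close>.\<close>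
  then have "v * (x * (real k)\<^sup>2) \<le> v * ((k + (x - 1) * l) * (v - y))"
    using x0 v by simp
  also have "\<dots> = (v - y) * ((real k - l) * v + (real l * v) * x)"
    by (simp add: algebra_simps)
  also have "real l * v = (real k)\<^sup>2 - (real k - l)"
    using degree_square[OF v] by simp
  finally have "(real k)\<^sup>2 * x * y \<le> (real k - l) * ((v - x) * (v - y))"
    by (simp add: algebra_simps)
  also have "\<dots> \<le> real k * ((v - x) * (v - y))"
    using card_free_le[OF assms] by (intro mult_right_mono) (auto simp: x_def y_def)
  finally show ?thesis
    using False unfolding x_def[symmetric] y_def[symmetric]
    by (simp add: power2_eq_square mult.assoc)
qed

lemma free_non_incident_blocks:
  assumes "S \<subseteq> P"
  shows "free S {b\<in>Q - Y. \<forall>p\<in>S. \<not> I p b}"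
  using assms by (auto simp: free_def)

lemma card_non_incident_blocks:
  assumes "Y \<subseteq> Q"
  shows "card {b\<in>Q - Y. \<forall>p\<in>S. \<not> I p b} + card {b\<in>Q - Y. \<exists>p\<in>S. I p b} + card Y = v"
proof -
  have "Q = ({b\<in>Q - Y. \<forall>p\<in>S. \<not> I p b} \<union> {b\<in>Q - Y. \<exists>p\<in>S. I p b}) \<union> Y"
    using assms by auto
  then have "v = card (({b\<in>Q - Y. \<forall>p\<in>S. \<not> I p b} \<union> {b\<in>Q - Y. \<exists>p\<in>S. I p b}) \<union> Y)"
    using card_Q by simp
  also have "\<dots> = card ({b\<in>Q - Y. \<forall>p\<in>S. \<not> I p b} \<union> {b\<in>Q - Y. \<exists>p\<in>S. I p b}) + card Y"
    using assms fin_Q finite_subset by (intro card_Un_disjoint) auto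
  also have "card ({b\<in>Q - Y. \<forall>p\<in>S. \<not> I p b} \<union> {b\<in>Q - Y. \<exists>p\<in>S. I p b})
      = card {b\<in>Q - Y. \<forall>p\<in>S. \<not> I p b} + card {b\<in>Q - Y. \<exists>p\<in>S. I p b}"
    using fin_Q by (intro card_Un_disjoint) auto
  finally show ?thesis by simp
qed

text \<open>Every block through \<open>p\<close> meeting \<open>X\<close> lies outside \<open>Y\<close>, and it has at most \<open>k - 1\<close> points in \<open>X\<close>.\<close>

lemma blocks_joining_point:
  assumes "free X Y" "p \<in> P - X"
  shows "l * card X + card {b\<in>Q - Y. I p b} \<le> card {b\<in>Q - Y. I p b} * k"
proof -
  let ?D = "{b\<in>Q - Y. I p b}"
  have X: "X \<subseteq> P" using assms by (auto simp: free_def)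
  have finX: "finite X" using X fin_P finite_subset by blast
  have "(\<Sum>b\<in>?D. card {x\<in>X. I x b}) = (\<Sum>x\<in>X. card {b\<in>?D. I x b})"
    using finX fin_Q by (intro sum_card_filter_swap) auto
  also have "\<dots> = (\<Sum>x\<in>X. l)"
  proof (rule sum.cong[OF refl])
    fix x assume x: "x \<in> X"
    then have "{b\<in>?D. I x b} = {b\<in>Q. I p b \<and> I x b}"
      using assms by (auto simp: free_def)
    then show "card {b\<in>?D. I x b} = l"
      using x X assms pair_degree[of p x] by auto
  qed
  \<comment> \<open>The added 1 stands for \<open>p\<close> itself, which lies outside
    \<open>X\<close>; this avoids subtraction in \<open>k - 1\<close>.\<close>
  finally have "l * card X + card ?D = (\<Sum>b\<in>?D. card {x\<in>X. I x b} + 1)"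
    by (subst sum.distrib) (simp add: mult.commute)
  also have "\<dots> \<le> (\<Sum>b\<in>?D. k)"
  proof (rule sum_mono)
    fix b assume b: "b \<in> ?D"
    have "card (insert p {x\<in>X. I x b}) \<le> card {x\<in>P. I x b}"
      using b assms X fin_P by (intro card_mono) auto
    then show "card {x\<in>X. I x b} + 1 \<le> k"
      using b assms finX block_degree by auto
  qed
  finally show ?thesis by simp
qed

section \<open>Hall's condition for a maximum pair\<close>

lemma small_set_expands:
  assumes k: "k \<ge> 100" and l: "l \<ge> 1"
    and XY: "free X Y" "card X = card Y"
    and S: "S \<subseteq> P - X" "card S \<le> card X"
  shows "card S \<le> card {b\<in>Q - Y. \<exists>p\<in>S. I p b}"
proof (rule ccontr)
  define T where "T = {b\<in>Q - Y. \<exists>p\<in>S. I p b}"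
  define Z where "Z = {b\<in>Q - Y. \<forall>p\<in>S. \<not> I p b}"
  define a where "a = card X"
  define s where "s = card S"
  define d where "d = (\<lambda>p. card {b\<in>Q - Y. I p b})"
  assume "\<not> card S \<le> card {b\<in>Q - Y. \<exists>p\<in>S. I p b}"
  then have T: "card T < s" by (simp add: T_def s_def)
  have finT: "finite T" unfolding T_def using fin_Q by simp
  have Y: "Y \<subseteq> Q" using XY by (auto simp: free_def)
  have SZ: "free S Z" unfolding Z_def using S by (intro free_non_incident_blocks) auto
  have cZ: "card Z + card T + a = v"
    using card_non_incident_blocks[OF Y, of S] XY(2) by (simp add: Z_def T_def a_def)
  have "5 * (real k * real s) \<le> 6 * real a"
  proof (rule small_set_bound[where v = v and z = "card Z"])
    show "real k * a * a \<le> (real v - a) * (real v - a)"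
      using free_mixing[OF XY(1)] XY(2) by (simp add: a_def)
    show "real k * s * card Z \<le> (real v - s) * (real v - card Z)"
      using free_mixing[OF SZ] by (simp add: s_def)
    show "real v \<le> real a + real s + real (card Z)" using cZ T by linarith
  qed (use k S T cZ in \<open>auto simp: a_def s_def\<close>)
  then have "real (5 * (k * s)) \<le> real (6 * a)" by simp
  then have ks: "5 * (k * s) \<le> 6 * a" by (rule of_nat_le_iff[THEN iffD1])
  have d_le: "d p \<le> card T" if "p \<in> S" for p
    unfolding d_def T_def using that fin_Q by (intro card_mono) auto
  have la: "l * a \<le> d p * k" if "p \<in> S" for p
    using blocks_joining_point[OF XY(1), of p] that S by (auto simp: d_def a_def)
  \<comment> \<open>Chains \<open>ks\<close> with \<open>la\<close> and cancels
    \<open>k\<close>.\<close>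
  have ls: "5 * (l * s) \<le> 6 * d p" if "p \<in> S" for p
  proof -
    have "k * (5 * (l * s)) = l * (5 * (k * s))" by simp
    also have "\<dots> \<le> l * (6 * a)" using ks by (rule mult_left_mono) simp
    also have "\<dots> \<le> k * (6 * d p)" using la[OF that] by (simp add: mult.commute)
    finally show ?thesis using k by simp
  qed
  obtain p where p: "p \<in> S" using T by (fastforce simp: s_def)
  have l1: "l = 1"
  proof (rule ccontr)
    assume "l \<noteq> 1"
    \<comment> \<open>With \<open>l \<ge> 2\<close>, \<open>ls\<close> would give
      \<open>10 * s \<le> 6 * d p\<close>, although \<open>d p \<le> card T < s\<close>.\<close>
    then have "2 * s \<le> l * s" using l by (intro mult_right_mono) auto
    then show False using ls[OF p] d_le[OF p] T by linarith
  qed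
  have ds: "5 * s \<le> 6 * d p" if "p \<in> S" for p using ls[OF that] l1 by simp
  have "s > 1" using ds[OF p] d_le[OF p] T by linarith
  have "\<not> S \<subseteq> {p}"
  proof
    assume "S \<subseteq> {p}"
    then have "card S \<le> card {p}" by (intro card_mono) simp_all
    then show False using \<open>s > 1\<close> by (simp add: s_def)
  qed
  then obtain q where q: "q \<in> S" "q \<noteq> p" by blast
  \<comment> \<open>The left side is at least 5/3 of \<open>s\<close>, while inclusion-exclusion
    bounds it by \<open>card T + 1 \<le> s\<close>.\<close>
  have "d p + d q = card ({b\<in>Q - Y. I p b} \<union> {b\<in>Q - Y. I q b})
      + card ({b\<in>Q - Y. I p b} \<inter> {b\<in>Q - Y. I q b})"
    unfolding d_def using fin_Q by (intro card_Un_Int) auto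
  also have "\<dots> \<le> card T + card {b\<in>Q. I p b \<and> I q b}"
    using finT fin_Q p q by (intro add_mono card_mono) (auto simp: T_def)
  also have "\<dots> = card T + 1"
    using pair_degree[of p q] p q S l1 by auto
  finally show False
    using ds[OF p] ds[OF q(1)] T \<open>s > 1\<close> by linarith
qed

text \<open>For \<open>S\<close> larger than \<open>X\<close>, the set \<open>Z\<close> of blocks
  outside \<open>Y\<close> missing \<open>S\<close> has at most \<open>card X\<close> elements, as
  otherwise trimming \<open>S\<close> and \<open>Z\<close> would give a larger pair. So
  \<open>Z\<close> expands in the dual, and its neighbours outside \<open>X\<close> avoid
  \<open>S\<close>; complementing yields the claim for \<open>S\<close>.\<close>

lemma max_free_expands:
  assumes k: "k \<ge> 100" and l: "l \<ge> 1"
    and XY: "free X Y" "card X = card Y"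
    and max: "\<And>X' Y'. free X' Y' \<Longrightarrow> card X' = card Y' \<Longrightarrow> card X' \<le> card X"
    and S: "S \<subseteq> P - X"
  shows "card S \<le> card {b\<in>Q - Y. \<exists>p\<in>S. I p b}"
proof (cases "card S \<le> card X")
  case True
  then show ?thesis using small_set_expands assms by blast
next
  case False
  interpret D: symmetric_incidence Q P "\<lambda>b p. I p b" v k l by (rule dual)
  define Z where "Z = {b\<in>Q - Y. \<forall>p\<in>S. \<not> I p b}"
  have X: "X \<subseteq> P" and Y: "Y \<subseteq> Q" using XY by (auto simp: free_def)
  have SZ: "free S Z" unfolding Z_def using S by (intro free_non_incident_blocks) auto
  have "card Z \<le> card X"
  proof (rule ccontr)
    assume "\<not> card Z \<le> card X"
    then obtain S' Z' where S': "S' \<subseteq> S" "card S' = Suc (card X)" and Z': "Z' \<subseteq> Z" "card Z' = Suc (card X)"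
      using False by (metis not_less_eq_eq obtain_subset_with_card_n)
    then have "free S' Z'" using SZ unfolding free_def by blast
    then show False using max S' Z' by force
  qed
  moreover have "D.free Y X" using XY by (auto simp: free_def D.free_def)
  ultimately have "card Z \<le> card {p\<in>P - X. \<exists>b\<in>Z. I p b}"
    using k l XY by (intro D.small_set_expands) (auto simp: Z_def)
  also have "\<dots> \<le> card (P - X - S)"
    using fin_P by (intro card_mono) (auto simp: Z_def)
  also have "\<dots> = v - card X - card S"
    using S X fin_P card_P by (simp add: card_Diff_subset finite_subset)
  finally have "card Z \<le> v - card X - card S" .
  \<comment> \<open>Ensures that the subtraction bounding \<open>card Z\<close> is not
    truncated.\<close>
  moreover have "card S \<le> v - card X"
    using card_mono[OF _ S] X fin_P card_P by (simp add: card_Diff_subset finite_subset)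
  ultimately show ?thesis
    using card_non_incident_blocks[OF Y, of S] XY(2) unfolding Z_def by linarith
qed

lemma max_free_complement_matching:
  assumes "k \<ge> 100" "l \<ge> 1" "free X Y" "card X = card Y"
    and "\<And>X' Y'. free X' Y' \<Longrightarrow> card X' = card Y' \<Longrightarrow> card X' \<le> card X"
  shows "\<exists>f. bij_betw f (P - X) (Q - Y) \<and> (\<forall>p\<in>P - X. I p (f p))"
proof -
  have X: "X \<subseteq> P" and Y: "Y \<subseteq> Q" using assms by (auto simp: free_def)
  have "\<exists>f. inj_on f (P - X) \<and> (\<forall>p\<in>P - X. f p \<in> {b\<in>Q - Y. I p b})"
  proof (rule Hall)
    fix S assume "S \<subseteq> P - X"
    moreover have "(\<Union>p\<in>S. {b\<in>Q - Y. I p b}) = {b\<in>Q - Y. \<exists>p\<in>S. I p b}" by auto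
    ultimately show "card S \<le> card (\<Union>p\<in>S. {b\<in>Q - Y. I p b})"
      using max_free_expands[OF assms] by simp
  qed (use fin_P fin_Q in auto)
  then obtain f where f: "inj_on f (P - X)" "\<forall>p\<in>P - X. f p \<in> {b\<in>Q - Y. I p b}" by blast
  have "card (P - X) = card (Q - Y)"
    using X Y fin_P fin_Q card_P card_Q assms(4) by (simp add: card_Diff_subset finite_subset)
  then have "f ` (P - X) = Q - Y"
    using f fin_Q card_image[OF f(1)] by (intro card_subset_eq) auto
  then show ?thesis using f by (auto simp: bij_betw_def)
qed

end

section \<open>Edge domination in the incidence graph\<close>

text \<open>The constant point degree \<open>r\<close> equals \<open>k\<close>: counting incidences
  gives \<open>v * k = v * r\<close>, and \<open>v > 0\<close> permits cancelling.\<close>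

lemma (in symmetric_design) symmetric_incidence:
  assumes "v > 0"
  shows "symmetric_incidence \<P> \<B> (\<in>) v k l"
proof -
  obtain r where r: "\<And>p. p \<in> \<P> \<Longrightarrow> card {B\<in>\<B>. p \<in> B} = r" using point_regular by blast
  have pts: "{p\<in>\<P>. p \<in> B} = B" if "B \<in> \<B>" for B using blocks_subset[OF that] by auto
  have "(\<Sum>B\<in>\<B>. card {p\<in>\<P>. p \<in> B}) = (\<Sum>p\<in>\<P>. card {B\<in>\<B>. p \<in> B})"
    using finite_points finite_blocks by (intro sum_card_filter_swap) auto
  then have "v * k = v * r"
    using pts r card_block card_points card_blocks by simp
  then have "r = k" using assms by simp
  then show ?thesis
    using r pts card_block card_points card_blocks pair_balanced finite_points finite_blocks
    by unfold_locales auto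
qed

lemma (in symmetric_design) edge_dominating_set_card_ge:
  assumes "edge_dominating_set (incidence_graph \<P> \<B>) \<Gamma>"
  shows "v \<le> card \<Gamma> + max_equinumerous_size \<P> \<B>"
proof -
  define C where "C = {p\<in>\<P>. \<exists>f\<in>\<Gamma>. Inl p \<in> f}"
  define D where "D = {B\<in>\<B>. \<exists>f\<in>\<Gamma>. Inr B \<in> f}"
  have \<Gamma>: "\<Gamma> \<subseteq> edges (incidence_graph \<P> \<B>)" "\<forall>e\<in>edges (incidence_graph \<P> \<B>). \<exists>f\<in>\<Gamma>. e \<inter> f \<noteq> {}"
    using assms by (auto simp: edge_dominating_set_def)
  have fin: "finite \<Gamma>" using \<Gamma> finite_incidence_graph_edges finite_subset by blast
  \<comment> \<open>Each edge has exactly one point, so \<open>THE\<close> recovers it and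
    \<open>\<Gamma>\<close> covers at most \<open>card \<Gamma>\<close> points.\<close>
  have "C \<subseteq> (\<lambda>f. THE p. Inl p \<in> f) ` \<Gamma>"
    using \<Gamma>(1) by (force simp: C_def incidence_graph_def image_iff)
  then have "card C \<le> card \<Gamma>" using fin by (metis card_image_le card_mono finite_imageI le_trans)
  then have cC: "v - card \<Gamma> \<le> card (\<P> - C)"
    using card_points finite_points by (simp add: C_def card_Diff_subset)
  have "D \<subseteq> (\<lambda>f. THE B. Inr B \<in> f) ` \<Gamma>"
    using \<Gamma>(1) by (force simp: D_def incidence_graph_def image_iff)
  then have "card D \<le> card \<Gamma>" using fin by (metis card_image_le card_mono finite_imageI le_trans)
  then have cD: "v - card \<Gamma> \<le> card (\<B> - D)"
    using card_blocks finite_blocks by (simp add: D_def card_Diff_subset)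
  \<comment> \<open>Both uncovered sets are trimmed to a common size, which is 0 when
    \<open>\<Gamma>\<close> has more than \<open>v\<close> edges.\<close>
  obtain X Y where X: "X \<subseteq> \<P> - C" "card X = v - card \<Gamma>" and Y: "Y \<subseteq> \<B> - D" "card Y = v - card \<Gamma>"
    using cC cD by (metis obtain_subset_with_card_n)
  have "p \<notin> B" if "p \<in> X" "B \<in> Y" for p B
  proof
    assume "p \<in> B"
    then have "{Inl p, Inr B} \<in> edges (incidence_graph \<P> \<B>)"
      using that X Y by (auto simp: incidence_graph_def)
    then obtain f where "f \<in> \<Gamma>" "{Inl p, Inr B} \<inter> f \<noteq> {}" using \<Gamma>(2) by blast
    then show False using that X(1) Y(1) by (auto simp: C_def D_def)
  qed
  then have "incidence_free \<P> \<B> X Y" using X Y by (auto simp: incidence_free_def)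
  then show ?thesis using max_equinumerous_size_attained(2)[of X Y] X Y by simp
qed

text \<open>The matching covers every vertex outside \<open>X\<close> and \<open>Y\<close>, and no
  edge joins \<open>X\<close> to \<open>Y\<close>.\<close>

lemma matching_edge_dominating:
  assumes free: "incidence_free \<P> \<B> X Y"
    and f: "bij_betw f (\<P> - X) (\<B> - Y)" "\<And>p. p \<in> \<P> - X \<Longrightarrow> p \<in> f p"
  shows "edge_dominating_set (incidence_graph \<P> \<B>) ((\<lambda>p. {Inl p, Inr (f p)}) ` (\<P> - X))"
  unfolding edge_dominating_set_def
proof (intro conjI ballI)
  have fB: "f p \<in> \<B>" if "p \<in> \<P> - X" for p
    using that f(1) bij_betwE by blast
  then show "(\<lambda>p. {Inl p, Inr (f p)}) ` (\<P> - X) \<subseteq> edges (incidence_graph \<P> \<B>)"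
    using f(2) by (auto simp: incidence_graph_def)
  fix e assume "e \<in> edges (incidence_graph \<P> \<B>)"
  then obtain p B where e: "e = {Inl p, Inr B}" "p \<in> \<P>" "B \<in> \<B>" "p \<in> B"
    by (auto simp: incidence_graph_def)
  have "p \<in> \<P> - X \<or> (\<exists>q\<in>\<P> - X. f q = B)"
  proof (cases "p \<in> X")
    case True
    then have "B \<in> \<B> - Y" using e free by (auto simp: incidence_free_def)
    then have "B \<in> f ` (\<P> - X)" by (simp only: bij_betw_imp_surj_on[OF f(1)])
    then show ?thesis by auto
  qed (use e in simp)
  then show "\<exists>g\<in>(\<lambda>p. {Inl p, Inr (f p)}) ` (\<P> - X). e \<inter> g \<noteq> {}"
    using e(1) by auto
qed

theorem theorem1p2:
  fixes \<P> :: "'a set" and \<B> :: "'a set set" and v k l :: nat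
  assumes "symmetric_design \<P> \<B> v k l"
    and "k \<ge> 100"
  shows "int (gamma_e \<P> \<B>) = int v - int (max_equinumerous_size \<P> \<B>)"
proof -
  interpret symmetric_design \<P> \<B> v k l by fact
  obtain X Y where XY: "incidence_free \<P> \<B> X Y" "card X = card Y" "card X = max_equinumerous_size \<P> \<B>"
    using max_equinumerous_size_attained(1) by blast
  have X: "X \<subseteq> \<P>" using XY by (simp add: incidence_free_def)
  have "\<exists>f. bij_betw f (\<P> - X) (\<B> - Y) \<and> (\<forall>p\<in>\<P> - X. p \<in> f p)"
  \<comment> \<open>The empty design has no point from which to derive the block and point degrees;
    the empty matching serves.\<close>
  proof (cases "v = 0")
    case True
    then have "\<P> = {}" "\<B> = {}"
      using card_points card_blocks finite_points finite_blocks by auto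
    then show ?thesis by (simp add: bij_betw_def)
  next
    case False
    then interpret I: symmetric_incidence \<P> \<B> "(\<in>)" v k l
      using symmetric_incidence by simp
    have free: "I.free X' Y' \<longleftrightarrow> incidence_free \<P> \<B> X' Y'" for X' Y'
      by (simp add: I.free_def incidence_free_def)
    show ?thesis
      using assms(2) l_pos XY max_equinumerous_size_attained(2)
      by (intro I.max_free_complement_matching) (auto simp: free)
  qed
  then obtain f where f: "bij_betw f (\<P> - X) (\<B> - Y)" "\<And>p. p \<in> \<P> - X \<Longrightarrow> p \<in> f p" by blast
  have "gamma_e \<P> \<B> \<le> card ((\<lambda>p. {Inl p, Inr (f p)} :: ('a + 'a set) set) ` (\<P> - X))"
    using matching_edge_dominating[OF XY(1) f] by (rule gamma_e_attained(2))
  also have "\<dots> \<le> card (\<P> - X)" using finite_points by (intro card_image_le) auto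
  also have "\<dots> = v - card X"
    using X finite_points card_points by (simp add: card_Diff_subset finite_subset)
  finally have "gamma_e \<P> \<B> \<le> v - max_equinumerous_size \<P> \<B>" using XY(3) by simp
  moreover have "v \<le> gamma_e \<P> \<B> + max_equinumerous_size \<P> \<B>"
    using gamma_e_attained(1) edge_dominating_set_card_ge by metis
  moreover have "max_equinumerous_size \<P> \<B> \<le> v"
    using XY(3) X finite_points card_points card_mono by metis
  ultimately show ?thesis by linarith
qed

end
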